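(* Let $n$ be a positive integer or $n=+\infty$, and let $f:\mathbb E\to\mathbb R\cup\{+\infty\}$ be a proper extended real function. Then $f$ is invex of order $n$ if and only if each stationary point $\bar x\in\mathrm{dom}\,f$ of order $n$ is a global minimizer of $f$.
   Context: $\mathbb E$ is a real finite-dimensional Euclidean space. $L^1(\mathbb E)=L(\mathbb E,\mathbb R)$ is the space of continuous linear functionals on $\mathbb E$ and, for $n>1$, $L^n(\mathbb E)=L(\mathbb E,L^{n-1}(\mathbb E))$. A proper extended real function is $f:\mathbb E\to\mathbb R\cup\{+\infty\}$ having at least one finite value; $\mathrm{dom}\,f=\{x\mid f(x)<+\infty\}$. For $x\in\mathrm{dom}\,f$ and $u\in\mathbb E$, \[ f^{(1)}_-(x;u)=\liminf_{t\downarrow 0,\,u'\to u}t^{-1}[f(x+tu')-f(x)],\qquad \partial^{(1)}_-f(x)=\{x^*\in L^1(\mathbb E)\mid x^*(u)\le f^{(1)}_-(x;u)\ \forall u\in\mathbb E\}. \] Recursively, for $n>1$: given $x^*_i\in\partial^{(i)}_-f(x;x_1^*,\dots,x_{i-1}^* )$ for $i=1,\dots,n-1$ (for $i=1$ this means $x_1^*\in\partial^{(1)}_-f(x)$), the lower Hadamard derivative of order $n$ is \[ f^{(n)}_-(x;x_1^*,\dots,x_{n-1}^*;u)=\liminf_{t\downarrow0,\,u'\to u} n!\,t^{-n}\Big[f(x+tu')-f(x)-\sum_{i=1}^{n-1}\frac{t^i}{i!}\,x_i^*\underbrace{(u')\cdots(u')}_{i\text{ times}}\Big]\in[-\infty,+\infty],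 \] and it is defined only for such $x_i^*$. The lower Hadamard subdifferential of order $n$ is \[ \partial^{(n)}_-f(x;x_1^*,\dots,x_{n-1}^* )=\{x^*\in L^n(\mathbb E)\mid x^*\underbrace{(u)\cdots(u)}_{n\text{ times}}\le f^{(n)}_-(x;x_1^*,\dots,x_{n-1}^*;u)\ \forall u\in\mathbb E\}. \] Below, in $f^{(i)}_-(\bar x;0,\dots,0;u)$ and $\partial^{(i)}_-f(\bar x;0,\dots,0)$ there are $i-1$ zeros. Stationary point of order $n$ ($n$ a positive integer): a point $\bar x\in\mathrm{dom}\,f$ such that $f^{(1)}_-(\bar x;u)\ge0$ and $f^{(k)}_-(\bar x;0,\dots,0;u)\ge0$ for $k=2,\dots,n$, for all $u\in\mathbb E$ (each derivative being well defined because the preceding conditions give $0\in\partial^{(i)}_-f(\bar x;0,\dots,0)$ for $i<k$). Stationary point of order $+\infty$: these inequalities hold for all integers $k\ge 2$, together with $f^{(1)}_-(\bar x;u)\ge0$, for all $u\in\mathbb E$. Invex of order $n$ ($n$ a positive integer): for every $\bar x\in\mathrm{dom}\,f$ and $x\in\mathbb E$ with $0\in\partial^{(1)}_-f(\bar x)$ and $0\in\partial^{(i)}_-f(\bar x;0,\dots,0)$, $i=2,\dots,n$, there are $\eta_1,\dots,\eta_n\in\mathbb E$, depending on $\bar x$ and $x$, such that \[ f(x)-f(\bar x)\ge f^{(1)}_-(\bar x;\eta_1)+\sum_{i=2}^n f^{(i)}_-(\bar x;0,\dots,0;\eta_i). \] Invex of order $+\infty$: the same with $n=+\infty$, i.e.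 for every $\bar x\in\mathrm{dom}\,f$, $x\in\mathbb E$ with $0\in\partial^{(1)}_-f(\bar x)$ and $0\in\partial^{(i)}_-f(\bar x;0,\dots,0)$ for all $i\ge2$, there is a sequence $\eta_1,\eta_2,\dots\in\mathbb E$ such that the inequality holds with the infinite sum $\sum_{i=2}^\infty$. *)

theory Defs
  imports "HOL-Analysis.Analysis"
begin

text \<open>
  Since \<open>L\<^sup>n(E)\<close> with variable \<open>n\<close> is a dependent type, an element of \<open>L\<^sup>n(E)\<close> is represented by its
  uncurried form: a function on lists, where \<open>\<phi> [u\<^sub>1, \<dots>, u\<^sub>n]\<close> stands for \<open>\<phi>(u\<^sub>1)\<dots>(u\<^sub>n)\<close> and where
  \<open>\<phi>\<close> is \<open>0\<close> on lists of any other length, so that the representation is unique.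
  The recursion is \<open>L\<^sup>n\<^sup>+\<^sup>1(E) = L(E, L\<^sup>n(E))\<close>, started at \<open>L\<^sup>0(E) = \<real>\<close>. The existence of \<open>K\<close> says that
  \<open>u \<mapsto> \<phi>(u)\<close> is bounded for the operator norm of \<open>L\<^sup>n(E)\<close>, i.e. continuous.
\<close>

primrec L_space :: "nat \<Rightarrow> ('a::euclidean_space list \<Rightarrow> real) set" where
  "L_space 0 = {\<phi>. \<forall>us. us \<noteq> [] \<longrightarrow> \<phi> us = 0}"
| "L_space (Suc n) = {\<phi>. \<phi> [] = 0
      \<and> (\<forall>u. (\<lambda>us. \<phi> (u # us)) \<in> L_space n)
      \<and> (\<forall>us. linear (\<lambda>u. \<phi> (u # us)))
      \<and> (\<exists>K. \<forall>u us. length us = n \<longrightarrow> \<bar>\<phi> (u # us)\<bar> \<le> K * norm u * prod_list (map norm us))}"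

abbreviation zero_form :: "'a::euclidean_space list \<Rightarrow> real" where
  "zero_form \<equiv> (\<lambda>_. 0)"

definition proper :: "('a::euclidean_space \<Rightarrow> ereal) \<Rightarrow> bool" where
  "proper f \<longleftrightarrow> (\<forall>x. f x \<noteq> -\<infinity>) \<and> (\<exists>x. f x < \<infinity>)"

definition edom :: "('a::euclidean_space \<Rightarrow> ereal) \<Rightarrow> 'a set" where
  "edom f = {x. f x < \<infinity>}"

text \<open>
  The list \<open>xs = [x\<^sub>1\<^sup>*, \<dots>, x\<^sub>n\<^sub>-\<^sub>1\<^sup>*]\<close> determines the order \<open>n = length xs + 1\<close>. As \<open>u'\<close> may equal
  \<open>u\<close>, the filter for \<open>u' \<rightarrow> u\<close> is \<open>nhds u\<close>, not the punctured \<open>at u\<close>.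
  The formula is meaningful only for \<open>x \<in> edom f\<close> and \<open>admissible f x xs\<close> (below).
\<close>

definition lower_deriv ::
    "('a::euclidean_space \<Rightarrow> ereal) \<Rightarrow> 'a \<Rightarrow> ('a list \<Rightarrow> real) list \<Rightarrow> 'a \<Rightarrow> ereal" where
  "lower_deriv f x xs u =
    (let n = Suc (length xs) in
      Liminf (at_right 0 \<times>\<^sub>F nhds u)
        (\<lambda>(t, u'). ereal (fact n / t ^ n) *
           (f (x + t *\<^sub>R u') - f x
             - ereal (\<Sum>i = 1..<n. t ^ i / fact i * (xs ! (i - 1)) (replicate i u')))))"

definition lower_subdiff ::
    "('a::euclidean_space \<Rightarrow> ereal) \<Rightarrow> 'a \<Rightarrow> ('a list \<Rightarrow> real) list \<Rightarrow> ('a list \<Rightarrow> real) set" where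
  "lower_subdiff f x xs =
    (let n = Suc (length xs) in
      {\<phi> \<in> L_space n. \<forall>u. ereal (\<phi> (replicate n u)) \<le> lower_deriv f x xs u})"

definition admissible ::
    "('a::euclidean_space \<Rightarrow> ereal) \<Rightarrow> 'a \<Rightarrow> ('a list \<Rightarrow> real) list \<Rightarrow> bool" where
  "admissible f x xs \<longleftrightarrow> (\<forall>i < length xs. xs ! i \<in> lower_subdiff f x (take i xs))"

abbreviation lower_deriv0 :: "('a::euclidean_space \<Rightarrow> ereal) \<Rightarrow> nat \<Rightarrow> 'a \<Rightarrow> 'a \<Rightarrow> ereal" where
  "lower_deriv0 f k x u \<equiv> lower_deriv f x (replicate (k - 1) zero_form) u"

abbreviation lower_subdiff0 ::
    "('a::euclidean_space \<Rightarrow> ereal) \<Rightarrow> nat \<Rightarrow> 'a \<Rightarrow> ('a list \<Rightarrow> real) set" where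
  "lower_subdiff0 f k x \<equiv> lower_subdiff f x (replicate (k - 1) zero_form)"

definition stationary :: "enat \<Rightarrow> ('a::euclidean_space \<Rightarrow> ereal) \<Rightarrow> 'a \<Rightarrow> bool" where
  "stationary n f x \<longleftrightarrow> x \<in> edom f \<and>
    (\<forall>k::nat. 1 \<le> k \<and> enat k \<le> n \<longrightarrow> (\<forall>u. 0 \<le> lower_deriv0 f k x u))"

text \<open>
  Under the hypothesis on \<open>x\<^sub>0\<close> all terms of the sums are nonnegative, so no \<open>\<infinity> - \<infinity>\<close> occurs and the
  infinite series always converges in \<open>[0, \<infinity>]\<close>.
\<close>

definition invex :: "enat \<Rightarrow> ('a::euclidean_space \<Rightarrow> ereal) \<Rightarrow> bool" where
  "invex n f \<longleftrightarrow>
    (\<forall>x\<^sub>0 \<in> edom f. \<forall>x.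
      (\<forall>i::nat. 1 \<le> i \<and> enat i \<le> n \<longrightarrow> zero_form \<in> lower_subdiff0 f i x\<^sub>0) \<longrightarrow>
      (\<exists>\<eta> :: nat \<Rightarrow> 'a.
        f x - f x\<^sub>0 \<ge> lower_deriv0 f 1 x\<^sub>0 (\<eta> 1) +
          (case n of
             enat m \<Rightarrow> (\<Sum>i = 2..m. lower_deriv0 f i x\<^sub>0 (\<eta> i))
           | \<infinity> \<Rightarrow> (\<Sum>i. lower_deriv0 f (i + 2) x\<^sub>0 (\<eta> (i + 2))))))"

lemma zero_form_in_L_space: "zero_form \<in> L_space n"
proof (induction n)
  case (Suc n)
  have "\<exists>K::real. \<forall>(u::'a) us. length us = n \<longrightarrow> \<bar>0\<bar> \<le> K * norm u * prod_list (map norm us)"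
    by (rule exI[of _ 0]) simp
  with Suc show ?case by (simp add: linear_zero)
qed simp

text \<open>The derivatives in the definition of a stationary point are well defined.\<close>

lemma stationary_admissible:
  assumes "stationary n f x" and "1 \<le> k" and "enat k \<le> n"
  shows "admissible f x (replicate (k - 1) zero_form)"
  unfolding admissible_def
proof (intro allI impI)
  fix i assume "i < length (replicate (k - 1) (zero_form :: 'a list \<Rightarrow> real))"
  then have i: "i < k - 1" by simp
  then have "enat (Suc i) \<le> enat k" by simp
  also note assms(3)
  finally have "\<forall>u. 0 \<le> lower_deriv0 f (Suc i) x u"
    using assms(1) unfolding stationary_def by (metis One_nat_def Suc_le_mono le0)
  then have "\<forall>u. 0 \<le> lower_deriv f x (replicate i zero_form) u"
    by simp
  then have "zero_form \<in> lower_subdiff f x (replicate i zero_form)"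
    unfolding lower_subdiff_def Let_def
    by (auto simp: zero_form_in_L_space zero_ereal_def simp del: L_space.simps)
  with i show "replicate (k - 1) zero_form ! i
      \<in> lower_subdiff f x (take i (replicate (k - 1) zero_form))"
    by (simp add: min_def)
qed

end

theory Submission
  imports Defs
begin

text \<open>
  The zero form lies in the order-\<open>k\<close> subdifferential exactly when the order-\<open>k\<close> derivative is
  nonnegative in every direction, so the base points quantified over in the definition of invexity
  are precisely the stationary points. At such a point every term of the invexity sum is
  nonnegative, so the inequality forces \<open>f x - f x\<^sub>0 \<ge> 0\<close>. Conversely, where \<open>f\<close> is finite its
  derivatives along the zero direction are at most \<open>0\<close>, hence equal to \<open>0\<close> at a stationary point;
  if that point is a global minimizer, choosing all \<open>\<eta>\<^sub>i = 0\<close> makes the sum vanish and the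
  inequality hold.
\<close>

lemma zero_form_in_lower_subdiff_iff:
  "zero_form \<in> lower_subdiff f x xs \<longleftrightarrow> (\<forall>u. 0 \<le> lower_deriv f x xs u)"
  unfolding lower_subdiff_def Let_def
  by (auto simp: zero_form_in_L_space zero_ereal_def simp del: L_space.simps)

text \<open>The right-hand side is the hypothesis on the base point in the definition of invexity.\<close>

lemma stationary_iff_zero_form:
  "stationary n f x \<longleftrightarrow> x \<in> edom f \<and>
     (\<forall>k::nat. 1 \<le> k \<and> enat k \<le> n \<longrightarrow> zero_form \<in> lower_subdiff0 f k x)"
  unfolding stationary_def zero_form_in_lower_subdiff_iff by blast

text \<open>
  The lower limit ranges over all \<open>u'\<close> near \<open>0\<close>, including \<open>u' = 0\<close> itself, where the difference
  quotient vanishes for every \<open>t\<close>.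
\<close>

lemma lower_deriv0_zero_direction_le:
  assumes "\<bar>f x\<bar> \<noteq> \<infinity>"
  shows "lower_deriv0 f k x 0 \<le> 0"
proof (rule ccontr)
  define g where "g t u' = ereal (fact (Suc (k - 1)) / t ^ Suc (k - 1)) *
      (f (x + t *\<^sub>R u') - f x
        - ereal (\<Sum>i = 1..<Suc (k - 1). t ^ i / fact i *
            (replicate (k - 1) zero_form ! (i - 1)) (replicate i u')))" for t u'
  have "lower_deriv0 f k x 0 = Liminf (at_right 0 \<times>\<^sub>F nhds 0) (\<lambda>(t, u'). g t u')"
    unfolding lower_deriv_def Let_def length_replicate g_def ..
  moreover assume "\<not> lower_deriv0 f k x 0 \<le> 0"
  ultimately have "0 < Liminf (at_right 0 \<times>\<^sub>F nhds 0) (\<lambda>(t, u'). g t u')"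
    by simp
  then have "\<forall>\<^sub>F p in at_right 0 \<times>\<^sub>F nhds 0. 0 < (\<lambda>(t, u'). g t u') p"
    by (rule less_LiminfD)
  then obtain P Q where P: "\<forall>\<^sub>F t in at_right 0. P t" and Q: "\<forall>\<^sub>F u' in nhds 0. Q u'"
    and PQ: "\<And>t u'. P t \<Longrightarrow> Q u' \<Longrightarrow> 0 < g t u'"
    unfolding eventually_prod_filter by auto
  obtain t where t: "P t"
    using eventually_happens'[OF _ P] by auto
  have "Q 0"
    using Q by (rule eventually_nhds_x_imp_x)
  with t have "0 < g t 0"
    by (rule PQ)
  moreover have "g t 0 = 0"
  proof -
    have "(\<Sum>i = 1..<Suc (k - 1). t ^ i / fact i *
          (replicate (k - 1) zero_form ! (i - 1)) (replicate i (0::'a))) = 0"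
      by (intro sum.neutral) auto
    with assms show ?thesis
      unfolding g_def by (simp add: zero_ereal_def[symmetric])
  qed
  ultimately show False by simp
qed

lemma stationary_lower_deriv0_zero_direction:
  assumes "stationary n f x" and "\<bar>f x\<bar> \<noteq> \<infinity>" and "1 \<le> k" and "enat k \<le> n"
  shows "lower_deriv0 f k x 0 = 0"
  using assms lower_deriv0_zero_direction_le[of f x k]
  unfolding stationary_def by (intro antisym) auto

theorem theorem4p1:
  fixes f :: "'a::euclidean_space \<Rightarrow> ereal" and n :: enat
  assumes "1 \<le> n" and "proper f"
  shows "invex n f \<longleftrightarrow> (\<forall>x. stationary n f x \<longrightarrow> (\<forall>y. f x \<le> f y))"
proof -
  define S where "S x \<eta> = lower_deriv0 f 1 x (\<eta> 1) +
      (case n of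
         enat m \<Rightarrow> (\<Sum>i = 2..m. lower_deriv0 f i x (\<eta> i))
       | \<infinity> \<Rightarrow> (\<Sum>i. lower_deriv0 f (i + 2) x (\<eta> (i + 2))))" for x and \<eta> :: "nat \<Rightarrow> 'a"
  have invex_iff: "invex n f \<longleftrightarrow> (\<forall>x. stationary n f x \<longrightarrow> (\<forall>y. \<exists>\<eta>. S x \<eta> \<le> f y - f x))"
    unfolding invex_def stationary_iff_zero_form S_def[symmetric]
    by (simp add: Ball_def imp_conjL)
  have finite: "\<bar>f x\<bar> \<noteq> \<infinity>" if "stationary n f x" for x
    using that assms(2) unfolding stationary_def edom_def proper_def by auto
  have one: "enat 1 \<le> n"
    using assms(1) by (simp add: one_enat_def)
  have nonneg: "0 \<le> S x \<eta>" if x: "stationary n f x" for x \<eta>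
  proof -
    have d: "0 \<le> lower_deriv0 f k x u" if "1 \<le> k" "enat k \<le> n" for k u
      using x that unfolding stationary_def by blast
    have "0 \<le> (case n of
         enat m \<Rightarrow> (\<Sum>i = 2..m. lower_deriv0 f i x (\<eta> i))
       | \<infinity> \<Rightarrow> (\<Sum>i. lower_deriv0 f (i + 2) x (\<eta> (i + 2))))"
    proof (cases n)
      case (enat m)
      then have "0 \<le> (\<Sum>i = 2..m. lower_deriv0 f i x (\<eta> i))"
        by (intro sum_nonneg d) auto
      with enat show ?thesis by simp
    next
      case infinity
      then have "0 \<le> lower_deriv0 f (i + 2) x (\<eta> (i + 2))" for i
        by (intro d) auto
      then have "0 \<le> (\<Sum>i. lower_deriv0 f (i + 2) x (\<eta> (i + 2)))"
        by (intro suminf_nonneg summable_ereal_pos)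
      with infinity show ?thesis by simp
    qed
    with d[OF order.refl one] show ?thesis
      unfolding S_def by (intro add_nonneg_nonneg)
  qed
  have zero: "S x (\<lambda>_. 0) = 0" if x: "stationary n f x" for x
  proof -
    have d: "lower_deriv0 f k x 0 = 0" if "1 \<le> k" "enat k \<le> n" for k
      using stationary_lower_deriv0_zero_direction[of n f x k] x finite[OF x] that by blast
    have "(case n of
         enat m \<Rightarrow> (\<Sum>i = 2..m. lower_deriv0 f i x 0)
       | \<infinity> \<Rightarrow> (\<Sum>i. lower_deriv0 f (i + 2) x 0)) = 0"
    proof (cases n)
      case (enat m)
      then have "(\<Sum>i = 2..m. lower_deriv0 f i x 0) = 0"
        by (intro sum.neutral ballI d) auto
      with enat show ?thesis by simp
    next
      case infinity
      then have "lower_deriv0 f (i + 2) x 0 = 0" for i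
        by (intro d) auto
      then have "(\<Sum>i. lower_deriv0 f (i + 2) x 0) = 0"
        by (simp only: suminf_zero)
      with infinity show ?thesis by simp
    qed
    with d[OF order.refl one] show ?thesis
      unfolding S_def by simp
  qed
  have diff: "0 \<le> f y - f x \<longleftrightarrow> f x \<le> f y" if "stationary n f x" for x y
    using finite[OF that] by (cases "f x"; cases "f y") auto
  show ?thesis
  proof
    assume inv: "invex n f"
    show "\<forall>x. stationary n f x \<longrightarrow> (\<forall>y. f x \<le> f y)"
    proof (intro allI impI)
      fix x y assume x: "stationary n f x"
      then obtain \<eta> where "S x \<eta> \<le> f y - f x"
        using inv unfolding invex_iff by auto
      with nonneg[OF x] have "0 \<le> f y - f x"
        by (rule order_trans)
      with diff[OF x] show "f x \<le> f y" by simp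
    qed
  next
    assume min: "\<forall>x. stationary n f x \<longrightarrow> (\<forall>y. f x \<le> f y)"
    show "invex n f"
      unfolding invex_iff
    proof (intro allI impI)
      fix x y assume x: "stationary n f x"
      with min have "f x \<le> f y" by simp
      with zero[OF x] diff[OF x] have "S x (\<lambda>_. 0) \<le> f y - f x" by simp
      then show "\<exists>\<eta>. S x \<eta> \<le> f y - f x"
        by (rule exI[of _ "\<lambda>_. 0"])
    qed
  qed
qed

end
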